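(* Let $(O,\le)$ be a quasi order and let $\Pi\subseteq\mathrm{Endo}(O,\le)$ be a subsemigroup of $(\mathrm{Endo}(O,\le),\circ)$. Then the $\Pi$-corrective augmentation $\le^{\mathrm{cor}}_{\Pi}$ is the minimum quasi order augmentation of $\le$ that is $\Pi$-correct; that is, $\le^{\mathrm{cor}}_{\Pi}$ is a quasi order augmentation of $\le$ which is $\Pi$-correct, and every $\Pi$-correct quasi order augmentation of $\le$ contains $\le^{\mathrm{cor}}_{\Pi}$.
   Context: A quasi order is a set with a reflexive transitive relation. $\mathrm{Endo}(O,\le)$ is the set of all order preserving maps $f:O\to O$ (i.e. $p\le q$ implies $f(p)\le f(q)$), a monoid under composition. An augmentation of a relation $\le$ on $O$ is a relation $\sqsubseteq$ on $O$ with $\le$ a subset of $\sqsubseteq$; a quasi order augmentation is one that is moreover a quasi order. For $\Pi$ a family of functions $O\to O$, a relation $\preceq$ on $O$ is $\Pi$-correct if for all $p,q\in O$ with $p\not\preceq q$ there is $\sigma\in\Pi$ such that $\tau(\sigma(p))\not\preceq\tau(\sigma(q))$ for all $\tau\in\Pi$. The $\Pi$-corrective augmentation of $\le$ is defined by: $p\le^{\mathrm{cor}}_{\Pi}q$ iff $p\le q$ or for every $\sigma\in\Pi$ there is $\tau\in\Pi$ with $\tau(\sigma(p))\le\tau(\sigma(q))$. *)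

theory Defs
  imports Main "HOL-Library.FuncSet"
begin

text \<open>
  Quasi orders on a carrier \<open>A\<close> are relations satisfying the library's \<open>preorder_on A\<close>.
  Self-maps of \<open>A\<close> are the extensional functions \<open>A \<rightarrow>\<^sub>E A\<close> (equal to \<open>undefined\<close> outside \<open>A\<close>),
  so that HOL equality is equality of maps on \<open>A\<close>; accordingly their composition is
  \<open>compose A\<close>.
\<close>

definition Endo :: "'a set \<Rightarrow> 'a rel \<Rightarrow> ('a \<Rightarrow> 'a) set" where
  "Endo A r = {f \<in> A \<rightarrow>\<^sub>E A. monotone_on A (\<lambda>p q. (p, q) \<in> r) (\<lambda>p q. (p, q) \<in> r) f}"

text \<open>The empty set counts as a subsemigroup.\<close>

definition subsemigroup_Endo :: "('a \<Rightarrow> 'a) set \<Rightarrow> 'a set \<Rightarrow> 'a rel \<Rightarrow> bool" where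
  "subsemigroup_Endo P A r \<longleftrightarrow> P \<subseteq> Endo A r \<and> (\<forall>\<sigma>\<in>P. \<forall>\<tau>\<in>P. compose A \<tau> \<sigma> \<in> P)"

definition augmentation :: "'a set \<Rightarrow> 'a rel \<Rightarrow> 'a rel \<Rightarrow> bool" where
  "augmentation A r s \<longleftrightarrow> s \<subseteq> A \<times> A \<and> r \<subseteq> s"

definition quasi_order_augmentation :: "'a set \<Rightarrow> 'a rel \<Rightarrow> 'a rel \<Rightarrow> bool" where
  "quasi_order_augmentation A r s \<longleftrightarrow> augmentation A r s \<and> preorder_on A s"

definition correct :: "'a set \<Rightarrow> ('a \<Rightarrow> 'a) set \<Rightarrow> 'a rel \<Rightarrow> bool" where
  "correct A P s \<longleftrightarrow>
     (\<forall>p\<in>A. \<forall>q\<in>A. (p, q) \<notin> s \<longrightarrow> (\<exists>\<sigma>\<in>P. \<forall>\<tau>\<in>P. (\<tau> (\<sigma> p), \<tau> (\<sigma> q)) \<notin> s))"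

definition corrective_augmentation :: "'a set \<Rightarrow> ('a \<Rightarrow> 'a) set \<Rightarrow> 'a rel \<Rightarrow> 'a rel" where
  "corrective_augmentation A P r =
     {(p, q) \<in> A \<times> A. (p, q) \<in> r \<or> (\<forall>\<sigma>\<in>P. \<exists>\<tau>\<in>P. (\<tau> (\<sigma> p), \<tau> (\<sigma> q)) \<in> r)}"

end

theory Submission
  imports Defs
begin

text \<open>
  Since the maps in \<open>P\<close> are monotone, \<open>p \<le> q\<close> already implies the second disjunct in the definition
  of the corrective augmentation (take \<open>\<tau> = \<sigma>\<close>), so that disjunct alone describes the relation.
  Transitivity and correctness then follow by merging successive witnesses in \<open>P\<close> by composition.
\<close>

lemma subsemigroup_Endo_closed:
  assumes "subsemigroup_Endo P A r" "\<sigma> \<in> P" "p \<in> A"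
  shows "\<sigma> p \<in> A"
  using assms by (auto simp: subsemigroup_Endo_def Endo_def)

lemma subsemigroup_Endo_mono:
  assumes "subsemigroup_Endo P A r" "\<sigma> \<in> P" "p \<in> A" "q \<in> A" "(p, q) \<in> r"
  shows "(\<sigma> p, \<sigma> q) \<in> r"
  using assms by (auto simp: subsemigroup_Endo_def Endo_def monotone_on_def)

text \<open>Turns closure under \<open>compose A\<close> into a pointwise equation, so that
  witnesses can later be merged by rewriting. The equation is restricted to \<open>A\<close> because
  \<open>compose A\<close> takes the value \<open>undefined\<close> elsewhere.\<close>

lemma subsemigroup_Endo_compose:
  assumes "subsemigroup_Endo P A r" "\<sigma> \<in> P" "\<tau> \<in> P"
  obtains \<rho> where "\<rho> \<in> P" "\<And>p. p \<in> A \<Longrightarrow> \<rho> p = \<tau> (\<sigma> p)"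
proof
  show "compose A \<tau> \<sigma> \<in> P"
    using assms by (simp add: subsemigroup_Endo_def)
qed (simp add: compose_eq)

lemma corrective_augmentation_iff:
  assumes P: "subsemigroup_Endo P A r" and pq: "p \<in> A" "q \<in> A"
  shows "(p, q) \<in> corrective_augmentation A P r \<longleftrightarrow>
           (\<forall>\<sigma>\<in>P. \<exists>\<tau>\<in>P. (\<tau> (\<sigma> p), \<tau> (\<sigma> q)) \<in> r)"
proof -
  have "(\<sigma> (\<sigma> p), \<sigma> (\<sigma> q)) \<in> r" if "(p, q) \<in> r" "\<sigma> \<in> P" for \<sigma>
    using subsemigroup_Endo_mono[OF P that(2)] subsemigroup_Endo_closed[OF P that(2)] that(1) pq
    by simp
  then show ?thesis
    using pq unfolding corrective_augmentation_def by blast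
qed

lemma trans_corrective_augmentation:
  assumes r: "trans r" and P: "subsemigroup_Endo P A r"
  shows "trans (corrective_augmentation A P r)"
proof (rule transI)
  fix p q u
  assume pq: "(p, q) \<in> corrective_augmentation A P r"
    and qu: "(q, u) \<in> corrective_augmentation A P r"
  then have A: "p \<in> A" "q \<in> A" "u \<in> A"
    by (auto simp: corrective_augmentation_def)
  have "\<exists>\<tau>\<in>P. (\<tau> (\<sigma> p), \<tau> (\<sigma> u)) \<in> r" if \<sigma>: "\<sigma> \<in> P" for \<sigma>
  proof -
    obtain \<tau> where \<tau>: "\<tau> \<in> P" "(\<tau> (\<sigma> p), \<tau> (\<sigma> q)) \<in> r"
      using pq \<sigma> corrective_augmentation_iff[OF P A(1,2)] by blast
    obtain \<tau>\<sigma> where \<tau>\<sigma>: "\<tau>\<sigma> \<in> P" "\<And>x. x \<in> A \<Longrightarrow> \<tau>\<sigma> x = \<tau> (\<sigma> x)"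
      using subsemigroup_Endo_compose[OF P \<sigma> \<tau>(1)] by blast
    \<comment> \<open>The hypothesis on \<open>q\<close> and \<open>u\<close> is applied to the
      composite \<open>\<tau>\<sigma>\<close> rather than to \<open>\<sigma>\<close>: the point
      \<tau>(\<sigma>(q)) then links the two comparisons.\<close>
    obtain \<rho> where \<rho>: "\<rho> \<in> P" "(\<rho> (\<tau>\<sigma> q), \<rho> (\<tau>\<sigma> u)) \<in> r"
      using qu \<tau>\<sigma>(1) corrective_augmentation_iff[OF P A(2,3)] by blast
    obtain \<rho>\<tau> where \<rho>\<tau>: "\<rho>\<tau> \<in> P" "\<And>x. x \<in> A \<Longrightarrow> \<rho>\<tau> x = \<rho> (\<tau> x)"
      using subsemigroup_Endo_compose[OF P \<tau>(1) \<rho>(1)] by blast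
    \<comment> \<open>Monotonicity of \<open>\<rho>\<close> carries the comparison obtained from
      \<open>p\<close> and \<open>q\<close> up to the level of the second one, where transitivity of
      \<open>r\<close> joins them.\<close>
    have "(\<rho> (\<tau> (\<sigma> p)), \<rho> (\<tau> (\<sigma> q))) \<in> r"
      using subsemigroup_Endo_mono[OF P \<rho>(1) _ _ \<tau>(2)] A
        subsemigroup_Endo_closed[OF P \<sigma>] subsemigroup_Endo_closed[OF P \<tau>(1)] by simp
    moreover have "(\<rho> (\<tau> (\<sigma> q)), \<rho> (\<tau> (\<sigma> u))) \<in> r"
      using \<rho>(2) \<tau>\<sigma>(2) A by simp
    ultimately have "(\<rho> (\<tau> (\<sigma> p)), \<rho> (\<tau> (\<sigma> u))) \<in> r"
      using r by (blast dest: transD)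
    then show ?thesis
      \<comment> \<open>The witness for \<open>\<sigma>\<close> is \<rho> after \<tau>, since
        \<open>\<sigma>\<close> itself has already been applied.\<close>
      using \<rho>\<tau> \<sigma> A subsemigroup_Endo_closed[OF P \<sigma>] by (intro bexI[of _ \<rho>\<tau>]) simp_all
  qed
  then show "(p, u) \<in> corrective_augmentation A P r"
    using A by (simp add: corrective_augmentation_iff[OF P])
qed

text \<open>The disjunct \<open>(p, q) \<in> r\<close> gives reflexivity and the inclusion of
  \<open>r\<close>; transitivity is where the subsemigroup structure enters.\<close>

lemma quasi_order_augmentation_corrective_augmentation:
  assumes "preorder_on A r" and P: "subsemigroup_Endo P A r"
  shows "quasi_order_augmentation A r (corrective_augmentation A P r)"
proof -
  have "r \<subseteq> A \<times> A" "refl_on A r" "trans r"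
    using assms(1) by (auto simp: preorder_on_def)
  then show ?thesis
    using trans_corrective_augmentation[OF _ P]
    by (auto simp: quasi_order_augmentation_def augmentation_def preorder_on_def refl_on_def
        corrective_augmentation_def)
qed

lemma correct_corrective_augmentation:
  assumes P: "subsemigroup_Endo P A r"
  shows "correct A P (corrective_augmentation A P r)"
proof -
  \<comment> \<open>This is correctness in contrapositive form: a pair that can always be repaired
    up to the corrective augmentation already belongs to it.\<close>
  have "(p, q) \<in> corrective_augmentation A P r"
    if A: "p \<in> A" "q \<in> A"
      and *: "\<forall>\<sigma>\<in>P. \<exists>\<tau>\<in>P. (\<tau> (\<sigma> p), \<tau> (\<sigma> q)) \<in> corrective_augmentation A P r"
    for p q
  proof -
    have "\<exists>\<tau>\<in>P. (\<tau> (\<sigma> p), \<tau> (\<sigma> q)) \<in> r" if \<sigma>: "\<sigma> \<in> P" for \<sigma>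
    proof -
      have \<sigma>A: "\<sigma> p \<in> A" "\<sigma> q \<in> A"
        using subsemigroup_Endo_closed[OF P \<sigma>] A by auto
      obtain \<tau> where \<tau>: "\<tau> \<in> P" "(\<tau> (\<sigma> p), \<tau> (\<sigma> q)) \<in> corrective_augmentation A P r"
        using * \<sigma> by blast
      have \<tau>A: "\<tau> (\<sigma> p) \<in> A" "\<tau> (\<sigma> q) \<in> A"
        using subsemigroup_Endo_closed[OF P \<tau>(1)] \<sigma>A by auto
      \<comment> \<open>The characterization is instantiated with \<open>\<tau>\<close>, merely as
        an element of \<open>P\<close> at hand; any other would serve. This is why
        \<open>\<tau>\<close> occurs twice and the final witness is \<rho> after \<tau> after
        \<tau>.\<close>
      obtain \<rho> where \<rho>: "\<rho> \<in> P" "(\<rho> (\<tau> (\<tau> (\<sigma> p))), \<rho> (\<tau> (\<tau> (\<sigma> q)))) \<in> r"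
        using \<tau> corrective_augmentation_iff[OF P \<tau>A] by blast
      obtain \<rho>\<tau> where \<rho>\<tau>: "\<rho>\<tau> \<in> P" "\<And>x. x \<in> A \<Longrightarrow> \<rho>\<tau> x = \<rho> (\<tau> x)"
        using subsemigroup_Endo_compose[OF P \<tau>(1) \<rho>(1)] by blast
      obtain \<rho>\<tau>\<tau> where \<rho>\<tau>\<tau>: "\<rho>\<tau>\<tau> \<in> P" "\<And>x. x \<in> A \<Longrightarrow> \<rho>\<tau>\<tau> x = \<rho>\<tau> (\<tau> x)"
        using subsemigroup_Endo_compose[OF P \<tau>(1) \<rho>\<tau>(1)] by blast
      show ?thesis
        using \<rho>(2) \<rho>\<tau>(2) \<rho>\<tau>\<tau> \<sigma>A \<tau>A by (intro bexI[of _ \<rho>\<tau>\<tau>]) simp_all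
    qed
    then show ?thesis
      using A by (simp add: corrective_augmentation_iff[OF P])
  qed
  then show ?thesis
    unfolding correct_def by blast
qed

text \<open>If a pair from \<open>A\<close> lies outside \<open>s\<close>, correctness supplies a
  \<sigma> for which every \<tau> fails in \<open>s\<close>, hence also in the smaller relation
  \<open>r\<close>. Both disjuncts of the definition then fail for that pair.\<close>

lemma corrective_augmentation_subset:
  assumes "augmentation A r s" "correct A P s"
  shows "corrective_augmentation A P r \<subseteq> s"
  using assms unfolding augmentation_def correct_def corrective_augmentation_def by blast

theorem corollary3p91:
  fixes A :: "'a set" and r :: "'a rel" and P :: "('a \<Rightarrow> 'a) set"
  assumes "preorder_on A r"
    and "subsemigroup_Endo P A r"
  shows "quasi_order_augmentation A r (corrective_augmentation A P r) \<and>
         correct A P (corrective_augmentation A P r) \<and>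
         (\<forall>s. quasi_order_augmentation A r s \<and> correct A P s \<longrightarrow>
              corrective_augmentation A P r \<subseteq> s)"
  using quasi_order_augmentation_corrective_augmentation[OF assms]
    correct_corrective_augmentation[OF assms(2)] corrective_augmentation_subset
  by (metis quasi_order_augmentation_def)

end
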